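(* Let $(\mathfrak g,B,S)$ be a quadratic Rota-Baxter Lie algebra of weight $-1$, let $\widetilde B=\mathrm{id}-B$, and let $(\mathfrak g_+,\mathfrak g_-,\rhd,\blacktriangleright)$ be the matched pair of Lie algebras on $(\mathfrak g,B)$. Let $S':(\mathfrak g_+\oplus\mathfrak g_-)\times(\mathfrak g_+\oplus\mathfrak g_-)\to\mathbb K$ be the (well defined) bilinear form $$S'\big((B(x_1),\widetilde B(x_2)),(B(y_1),\widetilde B(y_2))\big)=S(B(x_1),y_2)+S(B(y_1),x_2),\qquad\forall x_1,x_2,y_1,y_2\in\mathfrak g.$$ Then $((\mathfrak g_+\bowtie\mathfrak g_-,S'),\mathfrak g_+,\mathfrak g_-)$ is a Manin triple.
   Context: Lie algebras are over a field $\mathbb K$. A Rota-Baxter operator of weight $\lambda$ on a Lie algebra $\mathfrak g$ is a linear map $B:\mathfrak g\to\mathfrak g$ with $[B(x),B(y)]=B([B(x),y]+[x,B(y)]+\lambda[x,y])$ for all $x,y$; $(\mathfrak g,B)$ is then a Rota-Baxter Lie algebra of weight $\lambda$. A quadratic Lie algebra $(\mathfrak g,S)$ is a Lie algebra with a nondegenerate symmetric bilinear form $S:\mathfrak g\times\mathfrak g\to\mathbb K$ that is invariant: $S([x,y],z)=S(x,[y,z])$. A quadratic Rota-Baxter Lie algebra of weight $\lambda$ is a triple $(\mathfrak g,B,S)$ such that $(\mathfrak g,B)$ is a Rota-Baxter Lie algebra of weight $\lambda$, $(\mathfrak g,S)$ is a quadratic Lie algebra, and $S(B(x),y)+S(x,B(y))+\lambda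 S(x,y)=0$ for all $x,y$. A Manin triple is a triple $((\mathfrak d,S),\mathfrak d_+,\mathfrak d_-)$ where $(\mathfrak d,S)$ is a quadratic Lie algebra, $\mathfrak d_\pm$ are Lie subalgebras of $\mathfrak d$, $\mathfrak d=\mathfrak d_+\oplus\mathfrak d_-$ as vector spaces, and $\mathfrak d_+$, $\mathfrak d_-$ are isotropic with respect to $S$ (that is, $S$ vanishes on $\mathfrak d_+\times\mathfrak d_+$ and on $\mathfrak d_-\times\mathfrak d_-$). For $(\mathfrak g,B)$ of weight $-1$ put $\widetilde B=\mathrm{id}-B$, $\mathfrak g_+=\mathrm{Im}\,B$, $\mathfrak g_-=\mathrm{Im}\,\widetilde B$. The matched pair of Lie algebras on $(\mathfrak g,B)$ is $(\mathfrak g_+,\mathfrak g_-,\rhd,\blacktriangleright)$ with the well-defined maps $B(x)\rhd\widetilde B(y)=\widetilde B([B(x),y])$ and $\widetilde B(x)\blacktriangleright B(y)=B([\widetilde B(x),y])$. Its bicrossed product $\mathfrak g_+\bowtie\mathfrak g_-$ is the (external) vector space direct sum $\mathfrak g_+\oplus\mathfrak g_-$ with the Lie bracket $$[(x,u),(y,v)]_{\bowtie}=\big([x,y]+u\blacktriangleright y-v\blacktriangleright x,\ [u,v]+x\rhd v-y\rhd u\big);$$ $\mathfrak g_+$ and $\mathfrak g_-$ are identified with $\mathfrak g_+\oplus 0$ and $0\oplus\mathfrak g_-$. *)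

theory Defs
  imports "HOL-Analysis.Product_Vector"
begin

text \<open>
  All structures live on a subspace (the carrier \<open>g\<close>) of an ambient vector space; the operations
  are total functions and only their values on the carrier matter. No restriction is placed on the
  dimension or on the characteristic of the field.
\<close>

definition linear_on ::
  "('k::field \<Rightarrow> 'a::ab_group_add \<Rightarrow> 'a) \<Rightarrow> ('k \<Rightarrow> 'b::ab_group_add \<Rightarrow> 'b) \<Rightarrow> 'a set \<Rightarrow> ('a \<Rightarrow> 'b) \<Rightarrow> bool"
  where "linear_on s t V f \<longleftrightarrow>
    (\<forall>x\<in>V. \<forall>y\<in>V. f (x + y) = f x + f y) \<and> (\<forall>c. \<forall>x\<in>V. f (s c x) = t c (f x))"

definition bilinear_on ::
  "('k::field \<Rightarrow> 'a::ab_group_add \<Rightarrow> 'a) \<Rightarrow> ('k \<Rightarrow> 'b::ab_group_add \<Rightarrow> 'b) \<Rightarrow> 'a set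
    \<Rightarrow> ('a \<Rightarrow> 'a \<Rightarrow> 'b) \<Rightarrow> bool"
  where "bilinear_on s t V f \<longleftrightarrow>
    (\<forall>x\<in>V. linear_on s t V (\<lambda>y. f x y)) \<and> (\<forall>y\<in>V. linear_on s t V (\<lambda>x. f x y))"

locale lie_algebra = vector_space scale
  for scale :: "'k::field \<Rightarrow> 'a::ab_group_add \<Rightarrow> 'a" +
  fixes g :: "'a set" and br :: "'a \<Rightarrow> 'a \<Rightarrow> 'a"
  assumes subspace_carrier: "subspace g"
    and br_closed: "x \<in> g \<Longrightarrow> y \<in> g \<Longrightarrow> br x y \<in> g"
    and br_bilinear: "bilinear_on scale scale g br"
    and br_self: "x \<in> g \<Longrightarrow> br x x = 0"
    and jacobi: "x \<in> g \<Longrightarrow> y \<in> g \<Longrightarrow> z \<in> g \<Longrightarrow>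
      br x (br y z) + br y (br z x) + br z (br x y) = 0"
begin

definition lie_subalgebra :: "'a set \<Rightarrow> bool"
  where "lie_subalgebra h \<longleftrightarrow> subspace h \<and> h \<subseteq> g \<and> (\<forall>x\<in>h. \<forall>y\<in>h. br x y \<in> h)"

end

locale quadratic_lie_algebra = lie_algebra scale g br
  for scale :: "'k::field \<Rightarrow> 'a::ab_group_add \<Rightarrow> 'a" and g br +
  fixes S :: "'a \<Rightarrow> 'a \<Rightarrow> 'k"
  assumes form_bilinear: "bilinear_on scale (*) g S"
    and form_sym: "x \<in> g \<Longrightarrow> y \<in> g \<Longrightarrow> S x y = S y x"
    and form_nondegenerate: "x \<in> g \<Longrightarrow> (\<And>y. y \<in> g \<Longrightarrow> S x y = 0) \<Longrightarrow> x = 0"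
    and form_invariant: "x \<in> g \<Longrightarrow> y \<in> g \<Longrightarrow> z \<in> g \<Longrightarrow> S (br x y) z = S x (br y z)"

locale rota_baxter_lie_algebra = lie_algebra scale g br
  for scale :: "'k::field \<Rightarrow> 'a::ab_group_add \<Rightarrow> 'a" and g br +
  fixes B :: "'a \<Rightarrow> 'a" and wt :: 'k
  assumes rb_closed: "x \<in> g \<Longrightarrow> B x \<in> g"
    and rb_linear: "linear_on scale scale g B"
    and rota_baxter: "x \<in> g \<Longrightarrow> y \<in> g \<Longrightarrow>
      br (B x) (B y) = B (br (B x) y + br x (B y) + scale wt (br x y))"

locale quadratic_rota_baxter_lie_algebra =
  rota_baxter_lie_algebra scale g br B wt + quadratic_lie_algebra scale g br S
  for scale :: "'k::field \<Rightarrow> 'a::ab_group_add \<Rightarrow> 'a" and g br B wt S +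
  assumes form_rb: "x \<in> g \<Longrightarrow> y \<in> g \<Longrightarrow> S (B x) y + S x (B y) + wt * S x y = 0"

locale manin_triple = quadratic_lie_algebra scale d br S
  for scale :: "'k::field \<Rightarrow> 'a::ab_group_add \<Rightarrow> 'a" and d br S +
  fixes dplus dminus :: "'a set"
  assumes subalgebra_plus: "lie_subalgebra dplus"
    and subalgebra_minus: "lie_subalgebra dminus"
    and sum_eq: "{x + y |x y. x \<in> dplus \<and> y \<in> dminus} = d"
    and int_eq: "dplus \<inter> dminus = {0}"
    and isotropic_plus: "x \<in> dplus \<Longrightarrow> y \<in> dplus \<Longrightarrow> S x y = 0"
    and isotropic_minus: "x \<in> dminus \<Longrightarrow> y \<in> dminus \<Longrightarrow> S x y = 0"

definition rb_compl :: "('a::ab_group_add \<Rightarrow> 'a) \<Rightarrow> 'a \<Rightarrow> 'a"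
  where "rb_compl B x = x - B x"

definition rb_plus :: "'a set \<Rightarrow> ('a \<Rightarrow> 'a) \<Rightarrow> 'a::ab_group_add set"
  where "rb_plus g B = B ` g"

definition rb_minus :: "'a set \<Rightarrow> ('a \<Rightarrow> 'a) \<Rightarrow> 'a::ab_group_add set"
  where "rb_minus g B = rb_compl B ` g"

text \<open>
  The two actions of the matched pair and the form below are given through preimages under \<open>B\<close> and
  \<open>id - B\<close>. They are defined by choosing a preimage in \<open>g\<close> with \<^const>\<open>inv_into\<close>; the lemmas
  \<open>act_plus_eq\<close> and \<open>act_minus_eq\<close> show that the actions do not depend on the choice.
\<close>

definition act_plus :: "'a set \<Rightarrow> ('a \<Rightarrow> 'a \<Rightarrow> 'a) \<Rightarrow> ('a \<Rightarrow> 'a) \<Rightarrow> 'a \<Rightarrow> 'a \<Rightarrow> 'a::ab_group_add"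
  where "act_plus g br B x v = rb_compl B (br x (inv_into g (rb_compl B) v))"

definition act_minus :: "'a set \<Rightarrow> ('a \<Rightarrow> 'a \<Rightarrow> 'a) \<Rightarrow> ('a \<Rightarrow> 'a) \<Rightarrow> 'a \<Rightarrow> 'a \<Rightarrow> 'a::ab_group_add"
  where "act_minus g br B u y = B (br u (inv_into g B y))"

text \<open>
  Bracket of the bicrossed product, for an action \<open>r\<close> of the first summand on the second and
  an action \<open>l\<close> of the second on the first; both summands carry the bracket \<open>br\<close>.
\<close>

definition bicrossed_bracket ::
  "('a \<Rightarrow> 'a \<Rightarrow> 'a) \<Rightarrow> ('a \<Rightarrow> 'a \<Rightarrow> 'a) \<Rightarrow> ('a \<Rightarrow> 'a \<Rightarrow> 'a) \<Rightarrow> 'a \<times> 'a \<Rightarrow> 'a \<times> 'a \<Rightarrow> 'a \<times> 'a::ab_group_add"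
  where "bicrossed_bracket br r l = (\<lambda>(x, u) (y, v).
    (br x y + l u y - l v x, br u v + r x v - r y u))"

abbreviation rb_bicrossed_bracket ::
  "'a set \<Rightarrow> ('a \<Rightarrow> 'a \<Rightarrow> 'a) \<Rightarrow> ('a \<Rightarrow> 'a) \<Rightarrow> 'a \<times> 'a \<Rightarrow> 'a \<times> 'a \<Rightarrow> 'a \<times> 'a::ab_group_add"
  where "rb_bicrossed_bracket g br B \<equiv> bicrossed_bracket br (act_plus g br B) (act_minus g br B)"

definition rb_manin_form ::
  "'a set \<Rightarrow> ('a \<Rightarrow> 'a) \<Rightarrow> ('a \<Rightarrow> 'a \<Rightarrow> 'k::field) \<Rightarrow> 'a \<times> 'a \<Rightarrow> 'a \<times> 'a::ab_group_add \<Rightarrow> 'k"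
  where "rb_manin_form g B S = (\<lambda>(x, u) (y, v).
    S x (inv_into g (rb_compl B) v) + S y (inv_into g (rb_compl B) u))"

context rota_baxter_lie_algebra
begin

lemma br_diff_right:
  assumes "x \<in> g" "y \<in> g" "z \<in> g" shows "br x (y - z) = br x y - br x z"
proof -
  have "y - z \<in> g" using assms subspace_carrier subspace_diff by blast
  then have "br x ((y - z) + z) = br x (y - z) + br x z"
    using br_bilinear assms unfolding bilinear_on_def linear_on_def by blast
  then show ?thesis by simp
qed

lemma br_diff_left:
  assumes "x \<in> g" "y \<in> g" "z \<in> g" shows "br (y - z) x = br y x - br z x"
proof -
  have "y - z \<in> g" using assms subspace_carrier subspace_diff by blast
  then have "br ((y - z) + z) x = br (y - z) x + br z x"
    using br_bilinear assms unfolding bilinear_on_def linear_on_def by blast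
  then show ?thesis by simp
qed

lemma rb_diff:
  assumes "y \<in> g" "z \<in> g" shows "B (y - z) = B y - B z"
proof -
  have "y - z \<in> g" using assms subspace_carrier subspace_diff by blast
  then have "B ((y - z) + z) = B (y - z) + B z"
    using rb_linear assms unfolding linear_on_def by blast
  then show ?thesis by simp
qed

lemma rb_compl_closed: "x \<in> g \<Longrightarrow> rb_compl B x \<in> g"
  unfolding rb_compl_def using subspace_carrier rb_closed subspace_diff by blast

lemma br_image_split:
  assumes "wt = - 1" "x \<in> g" "y \<in> g"
  shows "br (B x) (rb_compl B y) = rb_compl B (br (B x) y) - B (br (rb_compl B y) x)"
proof -
  have add: "B (p + q) = B p + B q" if "p \<in> g" "q \<in> g" for p q
    using rb_linear that unfolding linear_on_def by blast
  have skew: "br p q = - br q p" if "p \<in> g" "q \<in> g" for p q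
  proof -
    have "br (p + q) (p + q) = br p p + br p q + (br q p + br q q)"
      using br_bilinear that subspace_add[OF subspace_carrier that]
      unfolding bilinear_on_def linear_on_def by (metis (no_types, lifting))
    then have "br p q + br q p = 0"
      using br_self that subspace_add[OF subspace_carrier that] by simp
    then show ?thesis by (simp add: eq_neg_iff_add_eq_0)
  qed
  have "br (B x) (B y) = B (br (B x) y + (br x (B y) - br x y))"
    using rota_baxter[OF assms(2,3)] assms(1) by (simp add: algebra_simps)
  also have "br x (B y) - br x y = br (rb_compl B y) x"
    using assms rb_closed skew[of x "B y"] skew[of x y] by (simp add: rb_compl_def br_diff_left)
  also have "B (br (B x) y + br (rb_compl B y) x) = B (br (B x) y) + B (br (rb_compl B y) x)"
    using assms rb_closed rb_compl_closed br_closed by (intro add) auto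
  finally show ?thesis
    using assms rb_closed by (simp add: rb_compl_def br_diff_right)
qed

lemma act_plus_eq:
  assumes wt: "wt = - 1" and x: "x \<in> g" and y: "y \<in> g"
  shows "act_plus g br B (B x) (rb_compl B y) = rb_compl B (br (B x) y)"
proof -
  let ?y = "inv_into g (rb_compl B) (rb_compl B y)"
  have y': "?y \<in> g" "rb_compl B ?y = rb_compl B y"
    using y by (auto intro: inv_into_into f_inv_into_f)
  show ?thesis
    using br_image_split[OF wt x y'(1)] br_image_split[OF wt x y] y'(2)
    by (simp add: act_plus_def)
qed

lemma act_minus_eq:
  assumes wt: "wt = - 1" and x: "x \<in> g" and y: "y \<in> g"
  shows "act_minus g br B (rb_compl B x) (B y) = B (br (rb_compl B x) y)"
proof -
  let ?y = "inv_into g B (B y)"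
  have y': "?y \<in> g" "B ?y = B y"
    using y by (auto intro: inv_into_into f_inv_into_f)
  show ?thesis
    using br_image_split[OF wt y'(1) x] br_image_split[OF wt y x] y'(2)
    by (simp add: act_minus_def)
qed

end

end

theory Submission
  imports Defs
begin

text \<open>
  Checking the Jacobi identity of the bicrossed product and the invariance of the form directly from
  the two actions is laborious. Instead, both are transported from a simpler Lie algebra, of which
  \<open>g\<^sub>+ \<bowtie> g\<^sub>-\<close> is a quotient. Write \<open>C = id - B\<close>.

  The sum map \<open>(x, u) \<mapsto> x + u\<close> is a homomorphism \<open>g\<^sub>+ \<bowtie> g\<^sub>- \<rightarrow> g\<close>, because
  \<open>[B a, C d] = C [B a, d] - B [C d, a]\<close>. To find the remaining part of the bracket,
  represent \<open>(x, u)\<close> as \<open>(B a, C b)\<close> and put \<open>s = x + u\<close>; likewise let \<open>(y, v) = (B c, C d)\<close>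
  and \<open>t = y + v\<close>. The Rota-Baxter identity turns the first component of the bracket into \<open>B e\<close> with
  \<open>e = [s, c] + [a, t] - [a, c] = [s, t] - [s - a, t - c]\<close>. Thus in the coordinates \<open>s\<close> and
  \<open>p = s - a = C (b - a)\<close> the bracket is componentwise: the map
  \<open>(s, p) \<mapsto> (B (s - p), s - B (s - p))\<close> (called \<open>rb_split\<close> below) is a surjective homomorphism
  from the direct product \<open>g \<times> g\<^sub>-\<close> onto \<open>g\<^sub>+ \<bowtie> g\<^sub>-\<close> (lemmas \<open>rb_split_image\<close> and
  \<open>rb_split_bracket\<close>), and the Jacobi identity passes to the image.

  The compatibility of \<open>S\<close> with \<open>B\<close> says that \<open>C\<close> is the adjoint of \<open>B\<close>. With it, the form \<open>S'\<close>
  pulls back to \<open>S(s, t) - S(p, q)\<close> (lemma \<open>rb_manin_form_rb_split\<close>), which is visibly symmetric and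
  invariant. Its radical on \<open>g \<times> g\<^sub>-\<close> lies in \<open>0 \<times> ker B\<close>, since \<open>S(p, C y) = S(B p, y)\<close>, and
  \<open>0 \<times> ker B\<close> is killed by the map; hence \<open>S'\<close> is nondegenerate. The two summands are subalgebras since
  \<open>g\<^sub>+\<close> and \<open>g\<^sub>-\<close> are subalgebras of \<open>g\<close> and an action by \<open>0\<close> or on \<open>0\<close> gives \<open>0\<close>; they are isotropic because each term of \<open>S'\<close> pairs
  a component in \<open>g\<^sub>+\<close> with one in \<open>g\<^sub>-\<close>.
\<close>

section \<open>Lie algebras on subspaces: subalgebras, products and images\<close>

lemma bilinear_onI:
  assumes "\<And>x y z. x \<in> V \<Longrightarrow> y \<in> V \<Longrightarrow> z \<in> V \<Longrightarrow> f x (y + z) = f x y + f x z"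
    and "\<And>x y z. x \<in> V \<Longrightarrow> y \<in> V \<Longrightarrow> z \<in> V \<Longrightarrow> f (y + z) x = f y x + f z x"
    and "\<And>c x y. x \<in> V \<Longrightarrow> y \<in> V \<Longrightarrow> f x (s c y) = t c (f x y)"
    and "\<And>c x y. x \<in> V \<Longrightarrow> y \<in> V \<Longrightarrow> f (s c x) y = t c (f x y)"
  shows "bilinear_on s t V f"
  using assms unfolding bilinear_on_def linear_on_def by blast

lemma bilinear_onD:
  assumes "bilinear_on s t V f" "x \<in> V" "y \<in> V"
  shows "z \<in> V \<Longrightarrow> f x (y + z) = f x y + f x z"
    and "z \<in> V \<Longrightarrow> f (y + z) x = f y x + f z x"
    and "f x (s c y) = t c (f x y)"
    and "f (s c x) y = t c (f x y)"
  using assms unfolding bilinear_on_def linear_on_def by blast+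

context lie_algebra
begin

lemma br_add_right: "x \<in> g \<Longrightarrow> y \<in> g \<Longrightarrow> z \<in> g \<Longrightarrow> br x (y + z) = br x y + br x z"
  and br_add_left: "x \<in> g \<Longrightarrow> y \<in> g \<Longrightarrow> z \<in> g \<Longrightarrow> br (y + z) x = br y x + br z x"
  and br_scale_right: "x \<in> g \<Longrightarrow> y \<in> g \<Longrightarrow> br x (scale c y) = scale c (br x y)"
  and br_scale_left: "x \<in> g \<Longrightarrow> y \<in> g \<Longrightarrow> br (scale c x) y = scale c (br x y)"
  using bilinear_onD[OF br_bilinear] by blast+

lemma br_swap:
  assumes "x \<in> g" "y \<in> g" shows "br x y = - br y x"
proof -
  have "br (x + y) (x + y) = br x y + br y x"
    using assms br_self[of x] br_self[of y]
    by (simp add: br_add_left br_add_right subspace_add[OF subspace_carrier])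
  moreover have "br (x + y) (x + y) = 0"
    using assms by (intro br_self subspace_add[OF subspace_carrier])
  ultimately have "br x y + br y x = 0" by (rule trans[OF sym])
  then show ?thesis by (simp add: eq_neg_iff_add_eq_0)
qed

lemma lie_algebra_subalgebra:
  assumes "lie_subalgebra h"
  shows "lie_algebra scale h br"
proof
  have sub: "h \<subseteq> g" and cl: "\<And>x y. x \<in> h \<Longrightarrow> y \<in> h \<Longrightarrow> br x y \<in> h"
    using assms unfolding lie_subalgebra_def by auto
  show "subspace h" using assms unfolding lie_subalgebra_def by auto
  show "br x y \<in> h" if "x \<in> h" "y \<in> h" for x y using cl that .
  show "bilinear_on scale scale h br"
    by (rule bilinear_onI)
      (use sub in \<open>auto simp: subset_iff br_add_left br_add_right br_scale_left br_scale_right\<close>)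
  show "br x x = 0" if "x \<in> h" for x using br_self sub that by blast
  show "br x (br y z) + br y (br z x) + br z (br x y) = 0"
    if "x \<in> h" "y \<in> h" "z \<in> h" for x y z using jacobi sub that by blast
qed

end

definition prod_bracket ::
  "('a \<Rightarrow> 'a \<Rightarrow> 'a) \<Rightarrow> ('b \<Rightarrow> 'b \<Rightarrow> 'b) \<Rightarrow> 'a \<times> 'b \<Rightarrow> 'a \<times> 'b \<Rightarrow> 'a \<times> 'b"
  where "prod_bracket br br' = (\<lambda>(x, u) (y, v). (br x y, br' u v))"

lemma lie_algebra_prod:
  assumes "lie_algebra s g br" and "lie_algebra t h br'"
  shows "lie_algebra (module_prod.scale s t) (g \<times> h) (prod_bracket br br')"
proof -
  interpret G: lie_algebra s g br by fact
  interpret H: lie_algebra t h br' by fact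
  interpret P: vector_space_prod s t ..
  show ?thesis
  proof
    show "P.p.subspace (g \<times> h)"
      using G.subspace_carrier H.subspace_carrier by (rule P.subspace_Times)
    show "bilinear_on P.scale P.scale (g \<times> h) (prod_bracket br br')"
      by (rule bilinear_onI)
        (auto simp: prod_bracket_def P.scale_prod G.br_add_left G.br_add_right G.br_scale_left
          G.br_scale_right H.br_add_left H.br_add_right H.br_scale_left H.br_scale_right)
  qed (auto simp: prod_bracket_def zero_prod_def G.br_closed H.br_closed G.br_self H.br_self
      G.jacobi H.jacobi)
qed

lemma lie_algebra_image:
  assumes lie: "lie_algebra s g br" and vs: "vector_space t" and f: "linear_on s t g f"
    and br': "\<And>x y. x \<in> g \<Longrightarrow> y \<in> g \<Longrightarrow> br' (f x) (f y) = f (br x y)"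
  shows "lie_algebra t (f ` g) br'"
proof -
  interpret lie_algebra s g br by fact
  interpret T: vector_space t by fact
  have add: "f x + f y = f (x + y)" if "x \<in> g" "y \<in> g" for x y
    using f that unfolding linear_on_def by simp
  have sc: "t c (f x) = f (s c x)" if "x \<in> g" for x c
    using f that unfolding linear_on_def by simp
  note closed = br_closed subspace_add[OF subspace_carrier] subspace_scale[OF subspace_carrier]
  have zero: "f 0 = 0"
    using add[of 0 0] subspace_0[OF subspace_carrier] by simp
  show ?thesis
  proof
    show "T.subspace (f ` g)"
      unfolding T.subspace_def
      using add sc closed zero subspace_0[OF subspace_carrier] by (auto intro: rev_image_eqI)
    show "bilinear_on t t (f ` g) br'"
      by (rule bilinear_onI)
        (auto simp: add sc br' closed br_add_left br_add_right br_scale_left br_scale_right)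
  qed (auto simp: br' closed add br_self jacobi zero)
qed

text \<open>
  The form \<open>S\<close> upstairs may be degenerate; the image is quadratic once the map kills the radical
  of \<open>S\<close>. This is how a quadratic Lie algebra arises as a quotient.
\<close>

lemma quadratic_lie_algebra_image:
  assumes lie: "lie_algebra s g br" and vs: "vector_space t" and f: "linear_on s t g f"
    and br': "\<And>x y. x \<in> g \<Longrightarrow> y \<in> g \<Longrightarrow> br' (f x) (f y) = f (br x y)"
    and bil: "bilinear_on s (*) g S"
    and sym: "\<And>x y. x \<in> g \<Longrightarrow> y \<in> g \<Longrightarrow> S x y = S y x"
    and inv: "\<And>x y z. x \<in> g \<Longrightarrow> y \<in> g \<Longrightarrow> z \<in> g \<Longrightarrow> S (br x y) z = S x (br y z)"
    and S': "\<And>x y. x \<in> g \<Longrightarrow> y \<in> g \<Longrightarrow> S' (f x) (f y) = S x y"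
    and radical: "\<And>x. x \<in> g \<Longrightarrow> (\<And>y. y \<in> g \<Longrightarrow> S x y = 0) \<Longrightarrow> f x = 0"
  shows "quadratic_lie_algebra t (f ` g) br' S'"
proof -
  interpret lie_algebra s g br by fact
  interpret T: lie_algebra t "f ` g" br'
    using lie vs f br' by (rule lie_algebra_image)
  have add: "f x + f y = f (x + y)" if "x \<in> g" "y \<in> g" for x y
    using f that unfolding linear_on_def by simp
  have sc: "t c (f x) = f (s c x)" if "x \<in> g" for x c
    using f that unfolding linear_on_def by simp
  note closed = br_closed subspace_add[OF subspace_carrier] subspace_scale[OF subspace_carrier]
  show ?thesis
  proof
    show "bilinear_on t (*) (f ` g) S'"
      by (rule bilinear_onI) (auto simp: add sc S' closed bilinear_onD[OF bil])
    show "x = 0" if "x \<in> f ` g" "\<And>y. y \<in> f ` g \<Longrightarrow> S' x y = 0" for x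
      using that radical S' by fastforce
    show "S' x y = S' y x" if "x \<in> f ` g" "y \<in> f ` g" for x y
      using that S' sym by auto
  qed (auto simp: br' S' closed inv)
qed

section \<open>Rota-Baxter operators of weight -1\<close>

context rota_baxter_lie_algebra
begin

lemma rb_add: "x \<in> g \<Longrightarrow> y \<in> g \<Longrightarrow> B (x + y) = B x + B y"
  and rb_scale: "x \<in> g \<Longrightarrow> B (scale c x) = scale c (B x)"
  using rb_linear unfolding linear_on_def by blast+

lemma rb_zero: "B 0 = 0"
  using rb_add[of 0 0] subspace_0[OF subspace_carrier] by simp

lemmas carrier_closed =
  rb_closed rb_compl_closed br_closed subspace_add[OF subspace_carrier]
  subspace_diff[OF subspace_carrier] subspace_neg[OF subspace_carrier]
  subspace_0[OF subspace_carrier] subspace_scale[OF subspace_carrier]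

lemma br_rb:
  assumes "wt = - 1" "x \<in> g" "y \<in> g"
  shows "br (B x) (B y) = B (br (B x) y + br x (B y) - br x y)"
  using rota_baxter[OF assms(2,3)] assms(1) by simp

text \<open>
  This is what makes \<open>g\<^sub>-\<close> a subalgebra. It is also the Rota-Baxter identity for the operator
  \<open>id - B\<close>, since \<open>[x, y] - [B x, y] - [x, B y]\<close> is
  \<open>[x - B x, y] + [x, y - B y] - [x, y]\<close>.
\<close>

lemma br_rb_compl:
  assumes wt: "wt = - 1" and "x \<in> g" "y \<in> g"
  shows "br (rb_compl B x) (rb_compl B y) =
    rb_compl B (br x y - br (B x) y - br x (B y))"
  using assms br_rb[OF assms]
  by (simp add: rb_compl_def br_diff_left br_diff_right rb_diff rb_add carrier_closed)

lemma lie_subalgebra_rb_plus: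
  assumes "wt = - 1" shows "lie_subalgebra (rb_plus g B)"
proof -
  have "0 \<in> B ` g"
    using rb_zero carrier_closed(7) by (metis imageI)
  then have "subspace (rb_plus g B)"
    unfolding subspace_def rb_plus_def
    by (auto simp: rb_add[symmetric] rb_scale[symmetric] carrier_closed)
  then show ?thesis
    unfolding lie_subalgebra_def rb_plus_def
    using br_rb[OF assms] by (auto simp: carrier_closed)
qed

lemma lie_subalgebra_rb_minus:
  assumes "wt = - 1" shows "lie_subalgebra (rb_minus g B)"
proof -
  have add: "rb_compl B x + rb_compl B y = rb_compl B (x + y)" if "x \<in> g" "y \<in> g" for x y
    using that by (simp add: rb_compl_def rb_add)
  have scale: "scale c (rb_compl B x) = rb_compl B (scale c x)" if "x \<in> g" for x c
    using that by (simp add: rb_compl_def rb_scale scale_right_diff_distrib)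
  have "rb_compl B 0 = 0"
    by (simp add: rb_compl_def rb_zero)
  then have "0 \<in> rb_compl B ` g"
    using carrier_closed(7) by (metis imageI)
  then have "subspace (rb_minus g B)"
    unfolding subspace_def rb_minus_def
    by (auto simp: add scale carrier_closed)
  then show ?thesis
    unfolding lie_subalgebra_def rb_minus_def
    using br_rb_compl[OF assms] by (auto simp: carrier_closed)
qed

section \<open>The bicrossed product as a quotient of a direct product\<close>

text \<open>
  The two components add up to \<open>s\<close>. The second coordinate \<open>p\<close> is meant to range over \<open>g\<^sub>-\<close>: this is
  what puts the second component into \<open>g\<^sub>-\<close>.
\<close>

definition rb_split :: "'a \<times> 'a \<Rightarrow> 'a \<times> 'a"
  where "rb_split = (\<lambda>(s, p). (B (s - p), s - B (s - p)))"

text \<open>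
  An explicit preimage of the second component under \<open>id - B\<close>, needed because the actions and the
  form are computed from preimages. It exists because \<open>B\<close> and \<open>id - B\<close> commute.
\<close>

lemma rb_split_rb_compl:
  assumes "s \<in> g" "r \<in> g"
  shows "rb_split (s, rb_compl B r) = (B (s - rb_compl B r), rb_compl B (s + B r))"
  using assms by (simp add: rb_split_def rb_compl_def rb_diff rb_add carrier_closed)

lemma rb_split_image: "rb_split ` (g \<times> rb_minus g B) = rb_plus g B \<times> rb_minus g B"
proof (intro equalityI subsetI)
  fix z assume "z \<in> rb_split ` (g \<times> rb_minus g B)"
  then show "z \<in> rb_plus g B \<times> rb_minus g B"
    by (auto simp: rb_minus_def rb_plus_def rb_split_rb_compl carrier_closed)
next
  fix z assume "z \<in> rb_plus g B \<times> rb_minus g B"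
  then obtain a b where ab: "a \<in> g" "b \<in> g" and z: "z = (B a, rb_compl B b)"
    unfolding rb_plus_def rb_minus_def by auto
  \<comment> \<open>The first coordinate must be the sum of the components, and \<open>s - p = a\<close> then forces
    \<open>p = B a + (b - B b) - a\<close>.\<close>
  have "rb_split (B a + rb_compl B b, rb_compl B (b - a)) = z"
    using ab by (simp add: z rb_split_def rb_compl_def rb_diff)
  then show "z \<in> rb_split ` (g \<times> rb_minus g B)"
    using ab unfolding rb_minus_def by (force simp: carrier_closed)
qed

lemma rb_split_linear:
  assumes "h \<subseteq> g"
  shows "linear_on (module_prod.scale scale scale) (module_prod.scale scale scale) (g \<times> h) rb_split"
proof -
  interpret P: vector_space_prod scale scale ..
  show ?thesis
    using assms
    unfolding linear_on_def rb_split_def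
    by (auto simp: P.scale_prod subset_iff carrier_closed rb_diff rb_add rb_scale
        scale_right_diff_distrib)
qed

text \<open>
  The first components agree by the Rota-Baxter identity, which gathers everything under one \<open>B\<close>.
  The second components need no separate computation: on both sides the two components
  add up to the bracket \<open>[s, t]\<close> of the sums.
\<close>

lemma rb_split_bracket:
  assumes wt: "wt = - 1" and z: "z \<in> g \<times> rb_minus g B" and z': "z' \<in> g \<times> rb_minus g B"
  shows "rb_bicrossed_bracket g br B (rb_split z) (rb_split z') =
    rb_split (prod_bracket br br z z')"
proof -
  obtain s r where z_eq: "z = (s, rb_compl B r)" and sr: "s \<in> g" "r \<in> g"
    using z unfolding rb_minus_def by auto
  obtain t w where z'_eq: "z' = (t, rb_compl B w)" and tw: "t \<in> g" "w \<in> g"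
    using z' unfolding rb_minus_def by auto
  define p q where "p = rb_compl B r" and "q = rb_compl B w"
  define a b c d where "a = s - p" and "b = s + B r" and "c = t - q" and "d = t + B w"
  define x u y v where "x = B a" and "u = rb_compl B b" and "y = B c" and "v = rb_compl B d"
  note defs = p_def q_def a_def b_def c_def d_def x_def u_def y_def v_def
  have pq: "p \<in> g" "q \<in> g" and ac: "a \<in> g" "b \<in> g" "c \<in> g" "d \<in> g"
    and xy: "x \<in> g" "u \<in> g" "y \<in> g" "v \<in> g"
    using sr tw by (auto simp: defs carrier_closed)
  note mem = sr tw pq ac xy
  have split: "rb_split z = (x, u)" "rb_split z' = (y, v)"
    using sr tw by (auto simp: z_eq z'_eq rb_split_rb_compl defs)
  have sum: "s = x + u" "t = y + v"
    using split by (auto simp: z_eq z'_eq rb_split_def)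
  \<comment> \<open>In the argument of \<open>B\<close>, the terms containing \<open>x, u, y, v\<close> combine to the sums \<open>s\<close> and \<open>t\<close>;
    the result is then \<open>[s, t] - [s - a, t - c]\<close> multiplied out.\<close>
  have "br x c + br a y - br a c + br u c - br v a = br s c + br a t - br a c"
    using mem br_swap[of v a] by (simp add: sum br_add_left br_add_right)
  also have "\<dots> = br s t - br p q"
    using mem by (simp add: a_def c_def br_diff_left br_diff_right carrier_closed)
  finally have arg: "br x c + br a y - br a c + br u c - br v a = br s t - br p q" .
  have "br x y + B (br u c) - B (br v a) = B (br x c + br a y - br a c + br u c - br v a)"
    using mem br_rb[OF wt ac(1,3), folded x_def y_def]
    by (simp add: rb_add rb_diff carrier_closed)
  also note arg
  finally have first: "br x y + B (br u c) - B (br v a) = B (br s t - br p q)" .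
  have "rb_compl B (br x d) = br x v + B (br v a)" "rb_compl B (br y b) = br y u + B (br u c)"
    using br_image_split[OF wt ac(1,4)] br_image_split[OF wt ac(3,2)]
    by (simp_all add: x_def y_def u_def v_def)
  moreover have "br s t = br x y + br u v + br x v - br y u"
    using mem br_swap[of u y] by (simp add: sum br_add_left br_add_right carrier_closed)
  ultimately have second: "br u v + rb_compl B (br x d) - rb_compl B (br y b)
      = br s t - (br x y + B (br u c) - B (br v a))"
    by (simp add: algebra_simps)
  have "act_minus g br B u y = B (br u c)" "act_minus g br B v x = B (br v a)"
    "act_plus g br B x v = rb_compl B (br x d)" "act_plus g br B y u = rb_compl B (br y b)"
    unfolding x_def u_def y_def v_def
    using act_minus_eq[OF wt] act_plus_eq[OF wt] ac by auto
  then show ?thesis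
    unfolding split bicrossed_bracket_def
    using first second
    by (simp add: z_eq z'_eq p_def[symmetric] q_def[symmetric] prod_bracket_def rb_split_def)
qed

end

section \<open>The invariant form and the Manin triple\<close>

text \<open>The orthogonal direct sum of \<open>S\<close> and \<open>- S\<close>.\<close>

definition diff_form :: "('a \<Rightarrow> 'a \<Rightarrow> 'k::field) \<Rightarrow> 'a \<times> 'a \<Rightarrow> 'a \<times> 'a \<Rightarrow> 'k"
  where "diff_form S = (\<lambda>(s, p) (t, q). S s t - S p q)"

context quadratic_lie_algebra
begin

lemma form_add_right: "x \<in> g \<Longrightarrow> y \<in> g \<Longrightarrow> z \<in> g \<Longrightarrow> S x (y + z) = S x y + S x z"
  and form_add_left: "x \<in> g \<Longrightarrow> y \<in> g \<Longrightarrow> z \<in> g \<Longrightarrow> S (y + z) x = S y x + S z x"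
  and form_scale_right: "x \<in> g \<Longrightarrow> y \<in> g \<Longrightarrow> S x (scale c y) = c * S x y"
  and form_scale_left: "x \<in> g \<Longrightarrow> y \<in> g \<Longrightarrow> S (scale c x) y = c * S x y"
  using bilinear_onD[OF form_bilinear] by blast+

lemma form_zero_right: "x \<in> g \<Longrightarrow> S x 0 = 0"
  using form_scale_right[of x 0 0] subspace_0[OF subspace_carrier] by simp

lemma form_zero_left: "x \<in> g \<Longrightarrow> S 0 x = 0"
  using form_scale_left[of 0 x 0] subspace_0[OF subspace_carrier] by simp

lemma form_diff_right: "x \<in> g \<Longrightarrow> y \<in> g \<Longrightarrow> z \<in> g \<Longrightarrow> S x (y - z) = S x y - S x z"
  using form_add_right[of x "y - z" z] subspace_diff[OF subspace_carrier, of y z] by simp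

lemma form_diff_left: "x \<in> g \<Longrightarrow> y \<in> g \<Longrightarrow> z \<in> g \<Longrightarrow> S (y - z) x = S y x - S z x"
  using form_add_left[of x "y - z" z] subspace_diff[OF subspace_carrier, of y z] by simp

lemma diff_form_bilinear:
  assumes "h \<subseteq> g"
  shows "bilinear_on (module_prod.scale scale scale) (*) (g \<times> h) (diff_form S)"
proof -
  interpret P: vector_space_prod scale scale ..
  show ?thesis
    by (rule bilinear_onI)
      (use assms in \<open>auto simp: diff_form_def P.scale_prod subset_iff form_add_left form_add_right
        form_scale_left form_scale_right algebra_simps\<close>)
qed

end

context quadratic_rota_baxter_lie_algebra
begin

lemma form_rb_adjoint:
  assumes "wt = - 1" "x \<in> g" "y \<in> g" shows "S (B x) y = S x (rb_compl B y)"
  using form_rb[OF assms(2,3)] assms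
  by (simp add: rb_compl_def form_diff_right rb_closed algebra_simps)

text \<open>
  By adjointness \<open>S(B a, b) = S(a, b - B b)\<close> depends on \<open>b\<close> only through \<open>b - B b\<close>, so the choice of
  preimage in the form is immaterial.
\<close>

lemma rb_manin_form_eq:
  assumes wt: "wt = - 1" and "x1 \<in> g" "x2 \<in> g" "y1 \<in> g" "y2 \<in> g"
  shows "rb_manin_form g B S (B x1, rb_compl B x2) (B y1, rb_compl B y2)
    = S (B x1) y2 + S (B y1) x2"
proof -
  have "S (B a) (inv_into g (rb_compl B) (rb_compl B b)) = S (B a) b"
    if "a \<in> g" "b \<in> g" for a b
  proof -
    let ?b = "inv_into g (rb_compl B) (rb_compl B b)"
    have "?b \<in> g" "rb_compl B ?b = rb_compl B b"
      using that by (auto intro: inv_into_into f_inv_into_f)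
    then show ?thesis using that by (simp add: form_rb_adjoint[OF wt])
  qed
  then show ?thesis using assms by (simp add: rb_manin_form_def)
qed

lemma rb_manin_form_rb_split:
  assumes wt: "wt = - 1" and z: "z \<in> g \<times> rb_minus g B" and z': "z' \<in> g \<times> rb_minus g B"
  shows "rb_manin_form g B S (rb_split z) (rb_split z') = diff_form S z z'"
proof -
  obtain s r where z_eq: "z = (s, rb_compl B r)" and sr: "s \<in> g" "r \<in> g"
    using z unfolding rb_minus_def by auto
  obtain t w where z'_eq: "z' = (t, rb_compl B w)" and tw: "t \<in> g" "w \<in> g"
    using z' unfolding rb_minus_def by auto
  define p q where "p = rb_compl B r" and "q = rb_compl B w"
  define a c where "a = s - p" and "c = t - q"
  have mem: "p \<in> g" "q \<in> g" "a \<in> g" "c \<in> g"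
    using sr tw by (auto simp: p_def q_def a_def c_def carrier_closed)
  have u: "rb_compl B (s + B r) = s - B a" and v: "rb_compl B (t + B w) = t - B c"
    using rb_split_rb_compl[OF sr] rb_split_rb_compl[OF tw]
    by (auto simp: rb_split_def a_def c_def p_def q_def)
  have "rb_manin_form g B S (rb_split z) (rb_split z') = S (B a) (t + B w) + S (B c) (s + B r)"
    using sr tw mem
    by (simp add: z_eq z'_eq rb_split_rb_compl rb_manin_form_eq[OF wt] carrier_closed
        a_def c_def p_def q_def)
  \<comment> \<open>Moving \<open>B\<close> across the form leaves an expression in \<open>B a\<close> and \<open>B c\<close>, and in the
    next steps these cancel by the compatibility of \<open>S\<close> and \<open>B\<close>.\<close>
  also have "\<dots> = S a (t - B c) + S c (s - B a)"
    using sr tw mem by (simp add: form_rb_adjoint[OF wt] u v carrier_closed)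
  also have "\<dots> = S a t + S c s - (S (B a) c + S a (B c))"
    using sr tw mem form_sym[of c "B a"] by (simp add: form_diff_right carrier_closed)
  also have "S (B a) c + S a (B c) = S a c"
    using form_rb[of a c] mem wt by (simp add: algebra_simps)
  also have "S a t + S c s - S a c = S s t - S p q"
    using sr tw mem form_sym[of s t] form_sym[of s q]
    by (simp add: a_def c_def form_diff_left form_diff_right carrier_closed)
  finally show ?thesis
    by (simp add: z_eq z'_eq p_def q_def diff_form_def)
qed

text \<open>
  The orthogonal complement of \<open>g\<^sub>-\<close> in \<open>g\<close> is \<open>ker B\<close>, because \<open>id - B\<close> is the adjoint of \<open>B\<close>; this
  applies to the second coordinate, and nondegeneracy of \<open>S\<close> on \<open>g\<close> to the first.
\<close>

lemma rb_split_radical: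
  assumes wt: "wt = - 1" and z: "z \<in> g \<times> rb_minus g B"
    and zero: "\<And>z'. z' \<in> g \<times> rb_minus g B \<Longrightarrow> diff_form S z z' = 0"
  shows "rb_split z = 0"
proof -
  obtain s p where z_eq: "z = (s, p)" and s: "s \<in> g" and p: "p \<in> g"
    using z unfolding rb_minus_def by (auto simp: carrier_closed)
  have 0: "0 \<in> rb_minus g B"
    using lie_subalgebra_rb_minus[OF wt] unfolding lie_subalgebra_def subspace_def by blast
  have "s = 0"
    using form_nondegenerate[OF s] zero[of "(t, 0)" for t] 0 p
    by (simp add: z_eq diff_form_def form_zero_right)
  have "S (B p) y = 0" if y: "y \<in> g" for y
    using zero[of "(0, rb_compl B y)"] y p s
    by (simp add: z_eq diff_form_def rb_minus_def carrier_closed form_zero_right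
        form_rb_adjoint[OF wt])
  then have "B p = 0"
    using form_nondegenerate[of "B p"] p by (simp add: carrier_closed)
  then show ?thesis
    using rb_diff[of 0 p] p
    by (simp add: z_eq \<open>s = 0\<close> rb_split_def zero_prod_def rb_zero carrier_closed)
qed

lemma quadratic_bicrossed:
  assumes wt: "wt = - 1"
  shows "quadratic_lie_algebra (module_prod.scale scale scale) (rb_plus g B \<times> rb_minus g B)
    (rb_bicrossed_bracket g br B) (rb_manin_form g B S)"
proof -
  interpret P: vector_space_prod scale scale ..
  have minus: "lie_subalgebra (rb_minus g B)"
    using wt by (rule lie_subalgebra_rb_minus)
  then have sub: "rb_minus g B \<subseteq> g"
    unfolding lie_subalgebra_def by blast
  show ?thesis
    unfolding rb_split_image[symmetric]
  proof (rule quadratic_lie_algebra_image)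
    show "lie_algebra P.scale (g \<times> rb_minus g B) (prod_bracket br br)"
      using lie_algebra_axioms lie_algebra_subalgebra[OF minus] by (rule lie_algebra_prod)
    show "vector_space P.scale" ..
    show "linear_on P.scale P.scale (g \<times> rb_minus g B) rb_split"
      using sub by (rule rb_split_linear)
    show "bilinear_on P.scale (*) (g \<times> rb_minus g B) (diff_form S)"
      using sub by (rule diff_form_bilinear)
    show "diff_form S z z' = diff_form S z' z"
      if "z \<in> g \<times> rb_minus g B" "z' \<in> g \<times> rb_minus g B" for z z'
      using that sub form_sym by (auto simp: diff_form_def subset_iff)
    show "diff_form S (prod_bracket br br x y) z = diff_form S x (prod_bracket br br y z)"
      if "x \<in> g \<times> rb_minus g B" "y \<in> g \<times> rb_minus g B" "z \<in> g \<times> rb_minus g B" for x y z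
      using that sub by (auto simp: diff_form_def prod_bracket_def subset_iff form_invariant)
  qed (simp_all add: rb_split_bracket[OF wt] rb_manin_form_rb_split[OF wt] rb_split_radical[OF wt])
qed

lemma manin_triple_bicrossed:
  assumes wt: "wt = - 1"
  shows "manin_triple (module_prod.scale scale scale) (rb_plus g B \<times> rb_minus g B)
    (rb_bicrossed_bracket g br B) (rb_manin_form g B S)
    (rb_plus g B \<times> {0}) ({0} \<times> rb_minus g B)"
proof -
  interpret P: vector_space_prod scale scale ..
  interpret Q: quadratic_lie_algebra P.scale "rb_plus g B \<times> rb_minus g B"
    "rb_bicrossed_bracket g br B" "rb_manin_form g B S"
    using wt by (rule quadratic_bicrossed)
  have plus: "subspace (rb_plus g B)" "\<And>x y. x \<in> rb_plus g B \<Longrightarrow> y \<in> rb_plus g B \<Longrightarrow> br x y \<in> rb_plus g B"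
    and minus: "subspace (rb_minus g B)" "\<And>x y. x \<in> rb_minus g B \<Longrightarrow> y \<in> rb_minus g B \<Longrightarrow> br x y \<in> rb_minus g B"
    using lie_subalgebra_rb_plus[OF wt] lie_subalgebra_rb_minus[OF wt]
    unfolding lie_subalgebra_def by auto
  have g0: "0 \<in> g" and c0: "rb_compl B 0 = 0"
    by (simp_all add: carrier_closed rb_compl_def rb_zero)
  have br0: "br 0 x = 0" "br x 0 = 0" if "x \<in> g" for x
    using that g0 br_add_left[of x 0 0] br_add_right[of x 0 0] by simp_all
  have act: "act_minus g br B 0 x = 0" "act_plus g br B x 0 = 0" if "x \<in> rb_plus g B" for x
    using that act_minus_eq[OF wt g0] act_plus_eq[OF wt _ g0]
    by (auto simp: rb_plus_def c0 br0 rb_zero carrier_closed)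
  have act': "act_minus g br B u 0 = 0" "act_plus g br B 0 u = 0" if "u \<in> rb_minus g B" for u
    using that act_minus_eq[OF wt _ g0] act_plus_eq[OF wt g0]
    by (auto simp: rb_minus_def c0 br0 rb_zero carrier_closed)
  note zero = subspace_0[OF plus(1)] subspace_0[OF minus(1)]
  show ?thesis
  proof
    show "Q.lie_subalgebra (rb_plus g B \<times> {0})"
      unfolding Q.lie_subalgebra_def
      using P.subspace_Times[OF plus(1) subspace_single_0] plus(2) zero g0
      by (auto simp: bicrossed_bracket_def act br0)
    show "Q.lie_subalgebra ({0} \<times> rb_minus g B)"
      unfolding Q.lie_subalgebra_def
      using P.subspace_Times[OF subspace_single_0 minus(1)] minus(2) zero g0
      by (auto simp: bicrossed_bracket_def act' br0)
    show "{x + y |x y. x \<in> rb_plus g B \<times> {0} \<and> y \<in> {0} \<times> rb_minus g B}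
        = rb_plus g B \<times> rb_minus g B"
      by force
    show "(rb_plus g B \<times> {0}) \<inter> ({0} \<times> rb_minus g B) = {0}"
      using zero by (auto simp: zero_prod_def)
    show "rb_manin_form g B S x y = 0"
      if "x \<in> rb_plus g B \<times> {0}" "y \<in> rb_plus g B \<times> {0}" for x y
      using that rb_manin_form_eq[OF wt _ g0 _ g0]
      by (auto simp: rb_plus_def c0 form_zero_right carrier_closed)
    show "rb_manin_form g B S x y = 0"
      if "x \<in> {0} \<times> rb_minus g B" "y \<in> {0} \<times> rb_minus g B" for x y
      using that rb_manin_form_eq[OF wt g0 _ g0]
      by (auto simp: rb_minus_def rb_zero form_zero_left carrier_closed)
  qed
qed

end

theorem proposition3p3:
  fixes scale :: "'k::field \<Rightarrow> 'a::ab_group_add \<Rightarrow> 'a"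
    and g :: "'a set" and br :: "'a \<Rightarrow> 'a \<Rightarrow> 'a" and B :: "'a \<Rightarrow> 'a" and S :: "'a \<Rightarrow> 'a \<Rightarrow> 'k"
  assumes "quadratic_rota_baxter_lie_algebra scale g br B (- 1) S"
  shows "(\<forall>x1\<in>g. \<forall>x2\<in>g. \<forall>y1\<in>g. \<forall>y2\<in>g.
            rb_manin_form g B S (B x1, rb_compl B x2) (B y1, rb_compl B y2)
              = S (B x1) y2 + S (B y1) x2) \<and>
         manin_triple (module_prod.scale scale scale) (rb_plus g B \<times> rb_minus g B)
           (rb_bicrossed_bracket g br B) (rb_manin_form g B S)
           (rb_plus g B \<times> {0}) ({0} \<times> rb_minus g B)"
proof -
  interpret quadratic_rota_baxter_lie_algebra scale g br B "- 1" S by fact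
  show ?thesis
    using rb_manin_form_eq[OF refl] manin_triple_bicrossed[OF refl] by blast
qed

end
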